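(* Let $\Phi$ be an irreducible root system with all roots of the same length, with simple roots $\Pi=\{\alpha_1,\dots,\alpha_l\}$ numbered as in the context, and let $N_{\alpha\beta}$ denote the structure constants of the corresponding Lie algebra with respect to a positive Chevalley basis. Let $\alpha_i\in\Pi$ be a simple root and let $\beta$ be such that $\beta$ and $\beta+\alpha_i$ are both positive roots. Then $N_{\alpha_i\beta}=-1$ if and only if $i$ is greater than the index of every simple root occurring (with nonzero coefficient) in the decomposition of $\beta$ as a sum of simple roots.
   Context: Numbering of simple roots: for $A_l$ the simple roots $\alpha_1,\dots,\alpha_l$ are numbered consecutively along the Dynkin diagram. For $D_l$ ($l\ge 4$), $\alpha_1$ and $\alpha_2$ are the two end nodes of the fork, both adjacent to $\alpha_3$, and $\alpha_3,\alpha_4,\dots,\alpha_l$ form a chain in this order (so $\alpha_i,\alpha_{i+1}$ are adjacent for $2\le i\le l-1$ and $\alpha_1,\alpha_3$ are adjacent). For $E_l$ ($l=6,7,8$) the numbering is that of Bourbaki: $\alpha_1,\alpha_3,\alpha_4,\alpha_5,\dots,\alpha_l$ is a chain in this order and $\alpha_2$ is adjacent to $\alpha_4$. Chevalley basis: $V=V(\Phi)$ is the Lie algebra of type $\Phi$ with a Chevalley basis $\{e_\alpha,\alpha\in\Phi;\ h_\alpha,\alpha\in\Pi\}$, so the $h_\alpha$ lie in the Cartan subalgebra, $[e_\alpha,e_{-\alpha}]=h_\alpha$, $[h_\alpha,e_\beta]=A_{\alpha\beta}e_\beta$ with $A_{\alpha\beta}=2(\alpha,\beta)/(\alpha,\alpha)$,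 $[e_\alpha,e_\beta]=N_{\alpha\beta}e_{\alpha+\beta}$ if $\alpha+\beta\in\Phi$, and $[e_\alpha,e_\beta]=0$ if $\alpha+\beta\notin\Phi$, $\beta\ne-\alpha$. The structure constants $N_{\alpha\beta}$ are integers, equal to $\pm1$ when $\alpha+\beta\in\Phi$ and $0$ when $\alpha+\beta\notin\Phi$ and $\beta\neq-\alpha$. They satisfy $N_{\alpha\beta}=N_{-\beta,-\alpha}=-N_{-\alpha,-\beta}=-N_{\beta\alpha}$. The Chevalley basis is called positive if $N_{\alpha_i\beta}=1$ whenever $\alpha_i$ is a simple root, $\beta\in\Phi^+$, $\alpha_i+\beta\in\Phi^+$, and $\alpha_i$ is the simple root with the smallest index that can be subtracted from $\alpha_i+\beta$; that is, whenever $\alpha_j+\gamma=\alpha_i+\beta$ with $\alpha_j\ne\alpha_i$ a simple root and $\gamma$ a positive root, one has $j>i$. *)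

theory Defs
  imports "HOL-Analysis.Analysis"
begin

section \<open>Root systems\<close>

definition root_reflection :: "'a::euclidean_space \<Rightarrow> 'a \<Rightarrow> 'a" where
  "root_reflection a b = b - (2 * (a \<bullet> b) / (a \<bullet> a)) *\<^sub>R a"

definition root_system :: "'a::euclidean_space set \<Rightarrow> bool" where
  "root_system R \<longleftrightarrow>
     finite R \<and> 0 \<notin> R \<and> span R = UNIV \<and>
     (\<forall>a\<in>R. \<forall>b\<in>R. root_reflection a b \<in> R) \<and>
     (\<forall>a\<in>R. \<forall>b\<in>R. 2 * (a \<bullet> b) / (a \<bullet> a) \<in> \<int>) \<and>
     (\<forall>a\<in>R. \<forall>c. c *\<^sub>R a \<in> R \<longrightarrow> c = 1 \<or> c = -1)"

definition irreducible_root_system :: "'a::euclidean_space set \<Rightarrow> bool" where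
  "irreducible_root_system R \<longleftrightarrow>
     root_system R \<and> R \<noteq> {} \<and>
     \<not> (\<exists>S T. S \<noteq> {} \<and> T \<noteq> {} \<and> S \<inter> T = {} \<and> S \<union> T = R \<and> (\<forall>a\<in>S. \<forall>b\<in>T. a \<bullet> b = 0))"

definition same_length :: "'a::euclidean_space set \<Rightarrow> bool" where
  "same_length R \<longleftrightarrow> (\<forall>a\<in>R. \<forall>b\<in>R. norm a = norm b)"

text \<open>The simple roots are the values of \<open>\<alpha>\<close> at the indices \<open>1, \<dots>, l\<close>; its other values are irrelevant.\<close>

definition simple_roots :: "'a::euclidean_space set \<Rightarrow> nat \<Rightarrow> (nat \<Rightarrow> 'a) \<Rightarrow> bool" where
  "simple_roots R l \<alpha> \<longleftrightarrow>
     inj_on \<alpha> {1..l} \<and> \<alpha> ` {1..l} \<subseteq> R \<and> independent (\<alpha> ` {1..l}) \<and>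
     (\<forall>b\<in>R. \<exists>c :: nat \<Rightarrow> nat.
        b = (\<Sum>j=1..l. real (c j) *\<^sub>R \<alpha> j) \<or> b = - (\<Sum>j=1..l. real (c j) *\<^sub>R \<alpha> j))"

definition positive_roots :: "'a::euclidean_space set \<Rightarrow> nat \<Rightarrow> (nat \<Rightarrow> 'a) \<Rightarrow> 'a set" where
  "positive_roots R l \<alpha> = {b \<in> R. \<exists>c :: nat \<Rightarrow> nat. b = (\<Sum>j=1..l. real (c j) *\<^sub>R \<alpha> j)}"

definition occurs_in :: "nat \<Rightarrow> (nat \<Rightarrow> 'a::euclidean_space) \<Rightarrow> nat \<Rightarrow> 'a \<Rightarrow> bool" where
  "occurs_in l \<alpha> j b \<longleftrightarrow> j \<in> {1..l} \<and> representation (\<alpha> ` {1..l}) b (\<alpha> j) \<noteq> 0"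

text \<open>For roots of equal length all edges of the Dynkin diagram are simple, so the diagram is the
  graph of non-orthogonality of the simple roots.\<close>

definition dynkin_edges :: "nat \<Rightarrow> (nat \<Rightarrow> 'a::euclidean_space) \<Rightarrow> nat set set" where
  "dynkin_edges l \<alpha> = {{i, j} | i j. i \<in> {1..l} \<and> j \<in> {1..l} \<and> i \<noteq> j \<and> \<alpha> i \<bullet> \<alpha> j \<noteq> 0}"

definition edges_A :: "nat \<Rightarrow> nat set set" where
  "edges_A l = {{i, i + 1} | i. 1 \<le> i \<and> i + 1 \<le> l}"

definition edges_D :: "nat \<Rightarrow> nat set set" where
  "edges_D l = insert {1, 3} {{i, i + 1} | i. 2 \<le> i \<and> i + 1 \<le> l}"

definition edges_E :: "nat \<Rightarrow> nat set set" where
  "edges_E l = insert {1, 3} (insert {2, 4} {{i, i + 1} | i. 3 \<le> i \<and> i + 1 \<le> l})"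

definition standard_numbering :: "nat \<Rightarrow> (nat \<Rightarrow> 'a::euclidean_space) \<Rightarrow> bool" where
  "standard_numbering l \<alpha> \<longleftrightarrow>
     (l \<ge> 1 \<and> dynkin_edges l \<alpha> = edges_A l) \<or>
     (l \<ge> 4 \<and> dynkin_edges l \<alpha> = edges_D l) \<or>
     (l \<in> {6, 7, 8} \<and> dynkin_edges l \<alpha> = edges_E l)"

text \<open>On a root system the argument of the floor function is an integer.\<close>

definition cartan_integer :: "'a::euclidean_space \<Rightarrow> 'a \<Rightarrow> int" where
  "cartan_integer a b = \<lfloor>2 * (a \<bullet> b) / (a \<bullet> a)\<rfloor>"


section \<open>Lie algebras\<close>

locale lie_algebra = vector_space scale
  for scale :: "'k::field \<Rightarrow> 'v::ab_group_add \<Rightarrow> 'v" +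
  fixes bracket :: "'v \<Rightarrow> 'v \<Rightarrow> 'v"
  assumes linear_right: "Vector_Spaces.linear scale scale (\<lambda>y. bracket x y)"
    and linear_left: "Vector_Spaces.linear scale scale (\<lambda>x. bracket x y)"
    and bracket_self: "bracket x x = 0"
    and jacobi: "bracket x (bracket y z) + bracket y (bracket z x) + bracket z (bracket x y) = 0"
begin

definition subalgebra :: "'v set \<Rightarrow> bool" where
  "subalgebra H \<longleftrightarrow> subspace H \<and> (\<forall>x\<in>H. \<forall>y\<in>H. bracket x y \<in> H)"

fun lower_central :: "'v set \<Rightarrow> nat \<Rightarrow> 'v set" where
  "lower_central H 0 = H"
| "lower_central H (Suc n) = span {bracket x y | x y. x \<in> H \<and> y \<in> lower_central H n}"

definition nilpotent :: "'v set \<Rightarrow> bool" where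
  "nilpotent H \<longleftrightarrow> (\<exists>n. lower_central H n = {0})"

definition cartan_subalgebra :: "'v set \<Rightarrow> bool" where
  "cartan_subalgebra H \<longleftrightarrow>
     subalgebra H \<and> nilpotent H \<and> {x. \<forall>y\<in>H. bracket x y \<in> H} = H"

end


section \<open>Chevalley bases\<close>

text \<open>\<open>R\<close> is a root system with all roots of the same length, \<open>B\<close> is its set of simple roots.
  The vector \<open>h a\<close> is given for every root \<open>a\<close>, but only those with \<open>a\<close> simple belong to the basis.
  A Lie algebra over a field of characteristic 0 carrying such a basis is the (split) Lie algebra
  of type \<open>R\<close>. The values of \<open>N\<close> at pairs \<open>a, -a\<close> and outside of \<open>R\<close> play no role.\<close>

locale chevalley_basis = lie_algebra scale bracket
  for scale :: "'k::field_char_0 \<Rightarrow> 'v::ab_group_add \<Rightarrow> 'v"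
    and bracket :: "'v \<Rightarrow> 'v \<Rightarrow> 'v" +
  fixes R :: "'a::euclidean_space set"
    and B :: "'a set"
    and H :: "'v set"
    and e :: "'a \<Rightarrow> 'v"
    and h :: "'a \<Rightarrow> 'v"
    and N :: "'a \<Rightarrow> 'a \<Rightarrow> int"
  assumes basis_inj: "inj_on (case_sum e h) (R <+> B)"
    and basis_independent: "\<not> dependent (case_sum e h ` (R <+> B))"
    and basis_span: "span (case_sum e h ` (R <+> B)) = UNIV"
    and cartan: "cartan_subalgebra H"
    and h_in_cartan: "a \<in> R \<Longrightarrow> h a \<in> H"
    and bracket_e_opposite: "a \<in> R \<Longrightarrow> bracket (e a) (e (- a)) = h a"
    and bracket_h_e: "\<lbrakk>a \<in> R; b \<in> R\<rbrakk> \<Longrightarrow>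
      bracket (h a) (e b) = scale (of_int (cartan_integer a b)) (e b)"
    and bracket_e_e: "\<lbrakk>a \<in> R; b \<in> R; a + b \<in> R\<rbrakk> \<Longrightarrow>
      bracket (e a) (e b) = scale (of_int (N a b)) (e (a + b))"
    and bracket_e_e_zero: "\<lbrakk>a \<in> R; b \<in> R; a + b \<notin> R; b \<noteq> - a\<rbrakk> \<Longrightarrow> bracket (e a) (e b) = 0"
    and N_unit: "\<lbrakk>a \<in> R; b \<in> R; a + b \<in> R\<rbrakk> \<Longrightarrow> N a b = 1 \<or> N a b = -1"
    and N_zero: "\<lbrakk>a \<in> R; b \<in> R; a + b \<notin> R; b \<noteq> - a\<rbrakk> \<Longrightarrow> N a b = 0"
    and N_symmetries: "\<lbrakk>a \<in> R; b \<in> R; b \<noteq> - a\<rbrakk> \<Longrightarrow>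
      N a b = N (- b) (- a) \<and> N a b = - N (- a) (- b) \<and> N a b = - N b a"

definition positive_structure_constants ::
    "'a::euclidean_space set \<Rightarrow> nat \<Rightarrow> (nat \<Rightarrow> 'a) \<Rightarrow> ('a \<Rightarrow> 'a \<Rightarrow> int) \<Rightarrow> bool" where
  "positive_structure_constants R l \<alpha> N \<longleftrightarrow>
     (\<forall>i\<in>{1..l}. \<forall>b\<in>positive_roots R l \<alpha>.
        \<alpha> i + b \<in> positive_roots R l \<alpha> \<longrightarrow>
        (\<forall>j\<in>{1..l}. \<forall>c\<in>positive_roots R l \<alpha>. \<alpha> j + c = \<alpha> i + b \<and> \<alpha> j \<noteq> \<alpha> i \<longrightarrow> j > i) \<longrightarrow>
        N (\<alpha> i) b = 1)"

end

(* Let k be the smallest index of a simple root that can be subtracted from the root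
   g = a_i + b.  If k = i, the constant is 1 by positivity; pairing g with itself shows that
   some simple root other than a_i occurring in b can be subtracted from g, so its index exceeds i.
   If k < i and a_i, a_k are not orthogonal, then g = a_i + a_k.  If they are orthogonal, then
   c = g - a_i - a_k is a positive root, the Jacobi identity gives
   N(a_i, b) = N(a_i, c) N(a_k, c), and one concludes by induction on the height of b.  Both factors
   are -1 only if i and k exceed all indices in the support of c; then both are joined to smaller
   nodes, and the numbering of the diagram forces i and k to be adjacent. *)

theory Submission
  imports Defs
begin

section \<open>Coordinates with respect to the simple roots\<close>

locale simply_laced =
  fixes R :: "'a::euclidean_space set" and l :: nat and \<alpha> :: "nat \<Rightarrow> 'a"
  assumes root_system: "root_system R"
    and same_length: "same_length R"
    and simple_roots: "simple_roots R l \<alpha>"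
begin

abbreviation "P \<equiv> positive_roots R l \<alpha>"

definition coef :: "'a \<Rightarrow> nat \<Rightarrow> real" where
  "coef b j = representation (\<alpha> ` {1..l}) b (\<alpha> j)"

lemma inj: "inj_on \<alpha> {1..l}"
  and simple_root: "j \<in> {1..l} \<Longrightarrow> \<alpha> j \<in> R"
  and independent: "independent (\<alpha> ` {1..l})"
  using simple_roots by (auto simp: simple_roots_def)

text \<open>Every root is an integer combination of simple roots, and the roots span the space. As
  \<open>representation\<close> is 0 outside the span, this is what makes \<open>coef\<close>
  additive on all vectors.\<close>

lemma span_simple: "span (\<alpha> ` {1..l}) = UNIV"
proof -
  have "b \<in> span (\<alpha> ` {1..l})" if b: "b \<in> R" for b
  proof -
    obtain c :: "nat \<Rightarrow> nat" where
      "b = (\<Sum>j=1..l. real (c j) *\<^sub>R \<alpha> j) \<or> b = - (\<Sum>j=1..l. real (c j) *\<^sub>R \<alpha> j)"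
      using simple_roots b unfolding simple_roots_def by blast
    then show ?thesis
      by (auto intro!: span_neg span_sum span_scale intro: span_base)
  qed
  then have "R \<subseteq> span (\<alpha> ` {1..l})" by blast
  then have "span R \<subseteq> span (\<alpha> ` {1..l})"
    by (simp add: span_minimal)
  then show ?thesis
    using root_system by (auto simp: root_system_def)
qed

lemma coef_add: "coef (a + b) j = coef a j + coef b j"
  unfolding coef_def using independent span_simple by (simp add: representation_add)

lemma coef_diff: "coef (a - b) j = coef a j - coef b j"
  using coef_add[of "a - b" b j] by simp

lemma coef_uminus: "coef (- a) j = - coef a j"
  using coef_diff[of 0 a j] coef_diff[of 0 0 j] by simp

lemma coef_simple: "j \<in> {1..l} \<Longrightarrow> k \<in> {1..l} \<Longrightarrow> coef (\<alpha> k) j = (if j = k then 1 else 0)"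
  unfolding coef_def using independent inj
  by (auto simp: representation_basis inj_on_eq_iff)

lemma coef_expansion: "(\<Sum>j=1..l. coef b j *\<^sub>R \<alpha> j) = b"
  using real_vector.sum_representation_eq[OF independent, of b "\<alpha> ` {1..l}"] span_simple
  by (simp add: coef_def sum.reindex[OF inj] del: One_nat_def)

lemma inner_coef: "b \<bullet> x = (\<Sum>j=1..l. coef b j * (\<alpha> j \<bullet> x))"
  by (subst coef_expansion[of b, symmetric]) (simp add: inner_sum_left)

lemma coef_eqI: "(\<And>j. j \<in> {1..l} \<Longrightarrow> coef a j = coef b j) \<Longrightarrow> a = b"
  by (metis (no_types, lifting) coef_expansion sum.cong)

lemma occurs_in_iff: "occurs_in l \<alpha> j b \<longleftrightarrow> j \<in> {1..l} \<and> coef b j \<noteq> 0"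
  by (simp add: occurs_in_def coef_def)

lemma coef_sum:
  assumes "k \<in> {1..l}"
  shows "coef (\<Sum>j=1..l. c j *\<^sub>R \<alpha> j) k = c k"
proof -
  have "coef (\<Sum>j=1..l. c j *\<^sub>R \<alpha> j) k = (\<Sum>j=1..l. c j * coef (\<alpha> j) k)"
    unfolding coef_def using independent span_simple
    by (simp add: representation_sum representation_scale)
  also have "\<dots> = (\<Sum>j=1..l. if j = k then c j else 0)"
    using assms by (intro sum.cong) (auto simp: coef_simple)
  finally show ?thesis using assms by simp
qed

section \<open>Positive roots and the signs of their coefficients\<close>

lemma positive_root: "b \<in> P \<Longrightarrow> b \<in> R"
  by (simp add: positive_roots_def)

lemma positive_coef_Nats: "b \<in> P \<Longrightarrow> j \<in> {1..l} \<Longrightarrow> coef b j \<in> \<nat>"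
  by (auto simp: positive_roots_def coef_sum simp del: One_nat_def)

lemma positive_coef: "b \<in> P \<Longrightarrow> j \<in> {1..l} \<Longrightarrow> coef b j \<ge> 0"
  using positive_coef_Nats[of b j] Nats_altdef2 by force

lemma root_nonzero: "b \<in> R \<Longrightarrow> b \<noteq> 0"
  using root_system by (auto simp: root_system_def)

lemma uminus_root:
  assumes "b \<in> R"
  shows "- b \<in> R"
proof -
  have "root_reflection b b \<in> R" using root_system assms by (auto simp: root_system_def)
  moreover have "root_reflection b b = - b"
    using root_nonzero[OF assms] by (simp add: root_reflection_def scaleR_2)
  ultimately show ?thesis by simp
qed

lemma root_cases: "b \<in> R \<Longrightarrow> b \<in> P \<or> - b \<in> P"
  using simple_roots uminus_root
  by (fastforce simp: simple_roots_def positive_roots_def)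

lemma positive_nonzero:
  assumes "b \<in> P"
  shows "\<exists>j\<in>{1..l}. coef b j > 0"
proof (rule ccontr)
  assume "\<not> ?thesis"
  then have "coef b j = coef 0 j" if "j \<in> {1..l}" for j
    using positive_coef[OF assms that] coef_diff[of 0 0 j] that by force
  then have "b = 0" by (rule coef_eqI)
  then show False using root_nonzero positive_root assms by blast
qed

lemma simple_positive: "k \<in> {1..l} \<Longrightarrow> \<alpha> k \<in> P"
proof -
  assume k: "k \<in> {1..l}"
  have "\<not> - \<alpha> k \<in> P"
    using positive_coef[of "- \<alpha> k" k] k by (auto simp: coef_uminus coef_simple)
  then show ?thesis using root_cases simple_root k by blast
qed

section \<open>Inner products of roots of equal length, and subtraction of simple roots\<close>

lemma inner_self: "a \<in> R \<Longrightarrow> b \<in> R \<Longrightarrow> a \<bullet> a = b \<bullet> b"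
  using same_length unfolding same_length_def by (metis dot_square_norm)

lemma inner_self_pos: "a \<in> R \<Longrightarrow> a \<bullet> a > 0"
  using root_nonzero by simp

text \<open>Expand \<open>(a + b) \<bullet> (a + b)\<close>; the three squared lengths agree. In
  particular orthogonal roots never add up to a root.\<close>

lemma inner_roots_add: "a \<in> R \<Longrightarrow> b \<in> R \<Longrightarrow> a + b \<in> R \<Longrightarrow> 2 * (a \<bullet> b) = - (a \<bullet> a)"
  using inner_self[of "a + b" a] inner_self[of a b]
  by (simp add: inner_add_left inner_add_right inner_commute)

text \<open>Equal lengths and \<open>a - b\<close> being nonzero put the Cartan integer strictly
  between 0 and 2. So it is 1, and the reflection in \<open>a\<close> just subtracts
  \<open>a\<close> from \<open>b\<close>.\<close>

lemma acute_roots: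
  assumes "a \<in> R" "b \<in> R" "a \<noteq> b" "a \<bullet> b > 0"
  shows "2 * (a \<bullet> b) = a \<bullet> a" and "b - a \<in> R"
proof -
  have aa: "a \<bullet> a > 0" and eq: "b \<bullet> b = a \<bullet> a"
    using inner_self_pos[OF assms(1)] inner_self[OF assms(2,1)] .
  have "(a - b) \<bullet> (a - b) > 0" using assms(3) by simp
  then have lt: "a \<bullet> b < a \<bullet> a"
    using eq by (simp add: inner_diff_left inner_diff_right inner_commute)
  have "2 * (a \<bullet> b) / (a \<bullet> a) \<in> \<int>"
    using root_system assms(1,2) by (auto simp: root_system_def)
  then obtain n :: int where n: "2 * (a \<bullet> b) / (a \<bullet> a) = of_int n"
    by (rule Ints_cases)
  have "0 < (of_int n::real)" "of_int n < (2::real)"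
    unfolding n[symmetric] using aa lt assms(4) by (auto simp: field_simps)
  then have n1: "n = 1" by simp
  then show "2 * (a \<bullet> b) = a \<bullet> a" using n aa by simp
  have "root_reflection a b \<in> R"
    using root_system assms(1,2) by (auto simp: root_system_def)
  then show "b - a \<in> R" using n n1 by (simp add: root_reflection_def)
qed

lemma obtuse_roots:
  assumes "a \<in> R" "b \<in> R" "a \<noteq> - b" "a \<bullet> b < 0"
  shows "2 * (a \<bullet> b) = - (a \<bullet> a)"
  using acute_roots(1)[of "- a" b] uminus_root[of a] assms by fastforce

text \<open>Otherwise the difference would be a root with coefficients of both signs.\<close>

lemma simple_acute_imp_eq:
  assumes "i \<in> {1..l}" "k \<in> {1..l}" "\<alpha> i \<bullet> \<alpha> k > 0"
  shows "i = k"
proof (rule ccontr)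
  assume ne: "i \<noteq> k"
  then have "\<alpha> i \<noteq> \<alpha> k" using inj assms by (auto simp: inj_on_eq_iff)
  then have "\<alpha> k - \<alpha> i \<in> R" using acute_roots assms simple_root by blast
  then have "\<alpha> k - \<alpha> i \<in> P \<or> - (\<alpha> k - \<alpha> i) \<in> P" by (rule root_cases)
  then show False
    using positive_coef[of "\<alpha> k - \<alpha> i" i] positive_coef[of "- (\<alpha> k - \<alpha> i)" k] ne assms
    by (auto simp: coef_uminus coef_diff coef_simple)
qed

text \<open>The difference is a root by \<open>acute_roots\<close>. Were it negative,
  \<open>b\<close> would be supported on \<open>k\<close> alone with a coefficient strictly between
  0 and 1, against integrality.\<close>

lemma positive_diff_simple:
  assumes b: "b \<in> P" and k: "k \<in> {1..l}" and ne: "b \<noteq> \<alpha> k" and pos: "\<alpha> k \<bullet> b > 0"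
  shows "b - \<alpha> k \<in> P"
proof -
  have "b - \<alpha> k \<in> R" using acute_roots assms simple_root positive_root by metis
  moreover have False if neg: "- (b - \<alpha> k) \<in> P"
  proof -
    obtain m where m: "m \<in> {1..l}" "coef (- (b - \<alpha> k)) m > 0"
      using positive_nonzero neg by blast
    obtain p where p: "p \<in> {1..l}" "coef b p > 0"
      using positive_nonzero b by blast
    have small: "coef b j \<le> (if j = k then 1 else 0)" if "j \<in> {1..l}" for j
      using positive_coef[OF neg that] k that by (simp add: coef_uminus coef_diff coef_simple)
    have "p = k" using small[OF p(1)] p(2) by (auto split: if_splits)
    moreover have "coef b m < (if m = k then 1 else 0)"
      using m k by (simp add: coef_uminus coef_diff coef_simple)
    then have "m = k \<and> coef b k < 1"
      using positive_coef[OF b m(1)] by (auto split: if_splits)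
    ultimately show False
      using p positive_coef_Nats[OF b k] by (auto elim!: Nats_cases)
  qed
  ultimately show ?thesis using root_cases by blast
qed

text \<open>Expanding \<open>b\<close> in simple roots, some summand of
  \<open>b \<bullet> \<alpha> k\<close> is negative. Its coefficient is nonnegative, so the simple
  root itself makes an obtuse angle with \<open>\<alpha> k\<close>.\<close>

lemma occurs_in_neighbour:
  assumes b: "b \<in> P" and k: "k \<in> {1..l}" and neg: "b \<bullet> \<alpha> k < 0"
  obtains j where "occurs_in l \<alpha> j b" "{j, k} \<in> dynkin_edges l \<alpha>"
proof -
  have "\<exists>j\<in>{1..l}. coef b j * (\<alpha> j \<bullet> \<alpha> k) < 0"
    using neg sum_nonneg[of "{1..l}" "\<lambda>j. coef b j * (\<alpha> j \<bullet> \<alpha> k)"]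
    unfolding inner_coef[of b] by (meson not_less)
  then obtain j where j: "j \<in> {1..l}" "coef b j * (\<alpha> j \<bullet> \<alpha> k) < 0" by blast
  then have "\<alpha> j \<bullet> \<alpha> k < 0" "coef b j \<noteq> 0"
    using positive_coef[OF b j(1)] by (auto simp: mult_less_0_iff)
  moreover from this have "j \<noteq> k" using inner_ge_zero[of "\<alpha> k"] by (metis not_less)
  ultimately have "{j, k} \<in> dynkin_edges l \<alpha>"
    using j k unfolding dynkin_edges_def by force
  then show thesis
    using that[of j] j(1) \<open>coef b j \<noteq> 0\<close> by (simp add: occurs_in_iff)
qed

text \<open>Pairing \<open>b\<close> with \<open>b + \<alpha> i\<close> gives a positive number, so
  some simple root in the support of \<open>b\<close> makes an acute angle with
  \<open>b + \<alpha> i\<close>.\<close>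

lemma subtractable_in_support:
  assumes i: "i \<in> {1..l}" and b: "b \<in> P" and g: "b + \<alpha> i \<in> P" and nocc: "\<not> occurs_in l \<alpha> i b"
  obtains j where "occurs_in l \<alpha> j b" "b + \<alpha> i - \<alpha> j \<in> P"
proof -
  define g where "g = b + \<alpha> i"
  have roots: "b \<in> R" "\<alpha> i \<in> R" "b + \<alpha> i \<in> R" using assms positive_root simple_root by auto
  \<comment> \<open>By \<open>inner_roots_add\<close>, \<open>b \<bullet> \<alpha> i\<close> cancels
    only half of \<open>b \<bullet> b\<close>.\<close>
  have bg: "b \<bullet> g > 0"
    using inner_roots_add[OF roots] inner_self_pos[OF roots(1)]
    unfolding g_def inner_add_right by linarith
  have "\<exists>j\<in>{1..l}. coef b j * (\<alpha> j \<bullet> g) > 0"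
    using bg sum_nonpos[of "{1..l}" "\<lambda>j. coef b j * (\<alpha> j \<bullet> g)"]
    unfolding inner_coef[of b] by (meson not_less)
  then obtain j where j: "j \<in> {1..l}" "coef b j * (\<alpha> j \<bullet> g) > 0" by blast
  then have jp: "\<alpha> j \<bullet> g > 0" "coef b j \<noteq> 0"
    using positive_coef[OF b j(1)] by (auto simp: zero_less_mult_iff)
  have "i \<noteq> j" using nocc jp j i by (auto simp: occurs_in_iff)
  \<comment> \<open>\<open>\<alpha> i\<close> occurs in \<open>g\<close>, whereas \<open>j\<close>
    differs from \<open>i\<close>; this excludes \<open>g = \<alpha> j\<close>, as subtraction
    requires.\<close>
  moreover have "coef g i \<ge> 1"
    using positive_coef[OF b i] i by (simp add: g_def coef_add coef_simple)
  ultimately have "g \<noteq> \<alpha> j" using i j by (auto simp: coef_simple)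
  then have "g - \<alpha> j \<in> P" using positive_diff_simple j jp assms unfolding g_def by blast
  then show thesis using that[of j] j jp by (simp add: g_def occurs_in_iff)
qed

text \<open>Real-valued because \<open>coef\<close> is; the induction uses its floor as a natural
  number.\<close>

definition height :: "'a \<Rightarrow> real" where
  "height b = (\<Sum>j=1..l. coef b j)"

lemma height_nonneg: "b \<in> P \<Longrightarrow> height b \<ge> 0"
  unfolding height_def using positive_coef by (intro sum_nonneg) auto

lemma height_add_simple:
  assumes "k \<in> {1..l}"
  shows "height (b + \<alpha> k) = height b + 1"
proof -
  have "(\<Sum>j=1..l. coef (\<alpha> k) j) = (\<Sum>j=1..l. if j = k then 1 else 0)"
    using assms by (intro sum.cong) (auto simp: coef_simple)
  then show ?thesis using assms by (simp add: height_def coef_add sum.distrib)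
qed

end

section \<open>Adjacency forced by the numbering of the diagrams\<close>

lemma standard_numbering_adjacent:
  assumes "standard_numbering l \<alpha>" "j < k" "k < i" "m < k"
    and "{j, i} \<in> dynkin_edges l \<alpha>" "{m, k} \<in> dynkin_edges l \<alpha>"
  shows "{k, i} \<in> dynkin_edges l \<alpha>"
proof -
  \<comment> \<open>An edge from \<open>j\<close> to \<open>i\<close> with \<open>k\<close> strictly
    between skips an index: there is none in A, only {1,3} in D, and {1,3} and {2,4} in E. For
    {1,3}, \<open>k\<close> is 2 and has no smaller neighbour. For {2,4}, \<open>k\<close> is 3 with
    smaller neighbour 1, and {3,4} is an edge because \<open>l\<close> is at least 6.\<close>
  consider "dynkin_edges l \<alpha> = edges_A l" | "dynkin_edges l \<alpha> = edges_D l"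
    | "l \<ge> 6" "dynkin_edges l \<alpha> = edges_E l"
    using assms(1) by (auto simp: standard_numbering_def)
  then show ?thesis
  proof cases
    case 1
    then show ?thesis using assms(2-) by (auto simp: edges_A_def doubleton_eq_iff)
  next
    case 2
    then show ?thesis using assms(2-) by (auto simp: edges_D_def doubleton_eq_iff)
  next
    case 3
    then show ?thesis using assms(2-) by (auto simp: edges_E_def doubleton_eq_iff)
  qed
qed

section \<open>Structure constants and the Jacobi identity\<close>

context chevalley_basis
begin

lemma e_nonzero:
  assumes "a \<in> R"
  shows "e a \<noteq> 0"
proof
  assume "e a = 0"
  moreover have "case_sum e h (Inl a) \<in> case_sum e h ` (R <+> B)"
    using assms by blast
  ultimately show False
    using basis_independent dependent_zero by simp
qed

lemma bracket_scale: "bracket x (scale c y) = scale c (bracket x y)"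
  using linear_right[of x] by (simp add: Vector_Spaces.linear_iff)

lemma bracket_zero: "bracket x 0 = 0"
  using bracket_scale[of x 0 0] by simp

text \<open>Since \<open>a + b\<close> is not a root, one of the three Jacobi terms for
  \<open>e a\<close>, \<open>e b\<close>, \<open>e c\<close> vanishes; the other two are multiples
  of the same nonzero root vector.\<close>

lemma N_jacobi:
  assumes "a \<in> R" "b \<in> R" "c \<in> R" "b + c \<in> R" "a + c \<in> R" "a + (b + c) \<in> R"
    and "a + b \<notin> R" "b \<noteq> - a" "c \<noteq> - a"
  shows "N b c * N a (b + c) = N a c * N b (a + c)"
proof -
  have "bracket (e a) (bracket (e b) (e c)) = scale (of_int (N b c * N a (b + c))) (e (a + (b + c)))"
    using assms by (simp add: bracket_e_e bracket_scale)
  moreover have "bracket (e b) (bracket (e c) (e a))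
      = scale (of_int (N c a * N b (a + c))) (e (a + (b + c)))"
    using assms by (simp add: bracket_e_e bracket_scale add.commute add.left_commute)
  moreover have "bracket (e c) (bracket (e a) (e b)) = 0"
    using assms by (simp add: bracket_e_e_zero bracket_zero)
  ultimately have "scale (of_int (N b c * N a (b + c) + N c a * N b (a + c))) (e (a + (b + c))) = 0"
    using jacobi[of "e a" "e b" "e c"] by (simp add: scale_left_distrib)
  then have "(of_int (N b c * N a (b + c) + N c a * N b (a + c)) :: 'k) = 0"
    using e_nonzero assms(6) scale_eq_0_iff by blast
  \<comment> \<open>Characteristic 0 turns the equation in the field into one of integers.\<close>
  then have "N b c * N a (b + c) + N c a * N b (a + c) = 0"
    by (simp only: of_int_eq_0_iff)
  moreover have "N a c = - N c a" using N_symmetries[of a c] assms by blast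
  ultimately show ?thesis by simp
qed

end

section \<open>The sign of \<open>N (\<alpha> i) \<beta>\<close>, by induction on the height\<close>

theorem mainTheorem1:
  fixes \<Phi> :: "'a::euclidean_space set"
    and l i :: nat
    and \<alpha> :: "nat \<Rightarrow> 'a"
    and \<beta> :: 'a
    and scale :: "'k::field_char_0 \<Rightarrow> 'v::ab_group_add \<Rightarrow> 'v"
    and bracket :: "'v \<Rightarrow> 'v \<Rightarrow> 'v"
    and H :: "'v set"
    and e h :: "'a \<Rightarrow> 'v"
    and N :: "'a \<Rightarrow> 'a \<Rightarrow> int"
  assumes "irreducible_root_system \<Phi>"
    and "same_length \<Phi>"
    and "simple_roots \<Phi> l \<alpha>"
    and "standard_numbering l \<alpha>"
    and "chevalley_basis scale bracket \<Phi> (\<alpha> ` {1..l}) H e h N"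
    and "positive_structure_constants \<Phi> l \<alpha> N"
    and "i \<in> {1..l}"
    and "\<beta> \<in> positive_roots \<Phi> l \<alpha>"
    and "\<beta> + \<alpha> i \<in> positive_roots \<Phi> l \<alpha>"
  shows "N (\<alpha> i) \<beta> = -1 \<longleftrightarrow> (\<forall>j. occurs_in l \<alpha> j \<beta> \<longrightarrow> j < i)"
proof -
  interpret simply_laced \<Phi> l \<alpha>
    using assms(1-3) by unfold_locales (auto simp: irreducible_root_system_def)
  interpret chevalley_basis scale bracket \<Phi> "\<alpha> ` {1..l}" H e h N by (fact assms(5))
  \<comment> \<open>Positivity restated through differences: \<open>j\<close> determines the other
    summand, and \<open>k \<le> j\<close> becomes strict when \<open>\<alpha> j\<close> and
    \<open>\<alpha> k\<close> differ.\<close>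
  have positive: "N (\<alpha> k) d = 1"
    if "k \<in> {1..l}" "d \<in> P" "\<alpha> k + d \<in> P"
      and "\<And>j. j \<in> {1..l} \<Longrightarrow> \<alpha> k + d - \<alpha> j \<in> P \<Longrightarrow> k \<le> j" for k d
  proof -
    have "j > k" if "j \<in> {1..l}" "c \<in> P" "\<alpha> j + c = \<alpha> k + d" "\<alpha> j \<noteq> \<alpha> k" for j c
    proof -
      have "c = \<alpha> k + d - \<alpha> j" using that(3) by (simp add: algebra_simps)
      then have "k \<le> j" using \<open>\<And>j. j \<in> {1..l} \<Longrightarrow> \<alpha> k + d - \<alpha> j \<in> P \<Longrightarrow> k \<le> j\<close> that by blast
      then show ?thesis using that(4) by (auto simp: order_le_less)
    qed
    then show ?thesis
      using assms(6) that(1-3) unfolding positive_structure_constants_def by blast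
  qed
  show ?thesis
    using assms(7-9)
  \<comment> \<open>The index must vary too: the hypothesis is applied to a smaller root with both
    \<open>i\<close> and \<open>k\<close>.\<close>
  proof (induction "nat \<lfloor>height \<beta>\<rfloor>" arbitrary: \<beta> i rule: less_induct)
    case less
    note i = less.prems(1) and b = less.prems(2) and g = less.prems(3)
    define \<gamma> where "\<gamma> = \<beta> + \<alpha> i"
    define k where "k = (LEAST j. j \<in> {1..l} \<and> \<gamma> - \<alpha> j \<in> P)"
    \<comment> \<open>\<open>i\<close> itself is subtractable, so the minimum exists and is at most
      \<open>i\<close>.\<close>
    have "i \<in> {1..l} \<and> \<gamma> - \<alpha> i \<in> P" using i b by (simp add: \<gamma>_def)
    then have k: "k \<in> {1..l}" "\<gamma> - \<alpha> k \<in> P" and ki: "k \<le> i"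
      and least: "\<And>j. j \<in> {1..l} \<Longrightarrow> \<gamma> - \<alpha> j \<in> P \<Longrightarrow> k \<le> j"
      unfolding k_def by (metis (mono_tags, lifting) LeastI Least_le)+
    have gP: "\<gamma> \<in> P" using g by (simp add: \<gamma>_def)
    have Nk: "N (\<alpha> k) (\<gamma> - \<alpha> k) = 1"
      using positive[of k "\<gamma> - \<alpha> k"] k gP least by simp
    have roots: "\<beta> \<in> \<Phi>" "\<alpha> i \<in> \<Phi>" "\<alpha> k \<in> \<Phi>" "\<gamma> \<in> \<Phi>" "\<gamma> - \<alpha> k \<in> \<Phi>"
      using i b k gP simple_root positive_root by auto
    show ?case
    proof (cases "k = i")
      case True
      have "\<not> (\<forall>j. occurs_in l \<alpha> j \<beta> \<longrightarrow> j < i)"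
      proof
        assume small: "\<forall>j. occurs_in l \<alpha> j \<beta> \<longrightarrow> j < i"
        \<comment> \<open>At \<open>j = i\<close>, \<open>small\<close> says that
          \<open>\<alpha> i\<close> does not occur in \<open>\<beta>\<close>. The subtractable root
          obtained then has index below \<open>i = k\<close>, against minimality.\<close>
        then obtain j where "occurs_in l \<alpha> j \<beta>" "\<beta> + \<alpha> i - \<alpha> j \<in> P"
          using subtractable_in_support[OF i b g] by blast
        then show False
          using small least[of j] True by (auto simp: \<gamma>_def occurs_in_iff)
      qed
      moreover have "N (\<alpha> i) \<beta> = 1" using Nk True by (simp add: \<gamma>_def)
      ultimately show ?thesis by simp
    next
      case False
      then have lt: "k < i" using ki by simp
      have len: "\<alpha> i \<bullet> \<alpha> i = \<gamma> \<bullet> \<gamma>" "\<alpha> k \<bullet> \<alpha> k = \<gamma> \<bullet> \<gamma>" "\<gamma> \<bullet> \<gamma> > 0"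
        using roots inner_self inner_self_pos by metis+
      have g_diff: "\<gamma> - \<alpha> i \<in> \<Phi>" using roots by (simp add: \<gamma>_def)
      have gi: "2 * (\<gamma> \<bullet> \<alpha> i) = \<gamma> \<bullet> \<gamma>"
        using inner_roots_add[of "\<alpha> i" "\<gamma> - \<alpha> i"] roots len g_diff
        by (simp add: inner_diff_right inner_commute)
      have gk: "2 * (\<gamma> \<bullet> \<alpha> k) = \<gamma> \<bullet> \<gamma>"
        using inner_roots_add[of "\<alpha> k" "\<gamma> - \<alpha> k"] roots len
        by (simp add: inner_diff_right inner_commute)
      have "\<not> \<alpha> i \<bullet> \<alpha> k > 0" using simple_acute_imp_eq i k False by blast
      then consider "\<alpha> i \<bullet> \<alpha> k < 0" | "\<alpha> i \<bullet> \<alpha> k = 0" by linarith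
      then show ?thesis
      proof cases
        case 1
        have "\<alpha> i \<noteq> - \<alpha> k"
          using coef_uminus[of "\<alpha> k" i] coef_simple[of i i] coef_simple[of i k] i k False by auto
        then have "2 * (\<alpha> i \<bullet> \<alpha> k) = - (\<gamma> \<bullet> \<gamma>)"
          using obtuse_roots roots 1 len by metis
        \<comment> \<open>With c the common squared length, the expansion is 3c - c - c - c.\<close>
        then have "(\<gamma> - (\<alpha> i + \<alpha> k)) \<bullet> (\<gamma> - (\<alpha> i + \<alpha> k)) = 0"
          using gi gk len by (simp add: algebra_simps inner_commute)
        then have g_eq: "\<gamma> = \<alpha> i + \<alpha> k" by simp
        then have \<beta>: "\<beta> = \<alpha> k" by (simp add: \<gamma>_def algebra_simps)
        \<comment> \<open>Here both sides of the equivalence hold: the constant is -1 by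
          antisymmetry, and the support of \<open>\<beta>\<close> is just \<open>k\<close>, below
          \<open>i\<close>.\<close>
        have "N (\<alpha> i) \<beta> = - N (\<alpha> k) (\<alpha> i)"
          using N_symmetries[of "\<alpha> i" "\<alpha> k"] roots \<beta> \<open>\<alpha> i \<noteq> - \<alpha> k\<close>
          by (metis add.inverse_inverse)
        also have "N (\<alpha> k) (\<alpha> i) = 1" using Nk g_eq by simp
        finally show ?thesis
          using lt k by (auto simp: \<beta> occurs_in_iff coef_simple split: if_splits)
      next
        case 2
        define \<epsilon> where "\<epsilon> = \<beta> - \<alpha> k"
        have bk: "\<alpha> k \<bullet> \<beta> > 0"
          using gk 2 len(3) inner_add_left[of \<beta> "\<alpha> i" "\<alpha> k"]
          unfolding \<gamma>_def[symmetric] inner_commute[of "\<alpha> k" \<beta>] by linarith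
        \<comment> \<open>This both rules out \<open>\<beta> = \<alpha> k\<close> and removes the
          third Jacobi term below.\<close>
        have sum_notin: "\<alpha> i + \<alpha> k \<notin> \<Phi>"
          using inner_roots_add[OF roots(2,3)] 2 inner_self_pos[OF roots(2)] by linarith
        then have "\<beta> \<noteq> \<alpha> k" using roots(4) by (auto simp: \<gamma>_def add.commute)
        then have eP: "\<epsilon> \<in> P" using positive_diff_simple b k bk by (simp add: \<epsilon>_def)
        have \<beta>: "\<beta> = \<epsilon> + \<alpha> k" and \<delta>: "\<gamma> - \<alpha> k = \<epsilon> + \<alpha> i"
          by (simp_all add: \<epsilon>_def \<gamma>_def)
        have eR: "\<epsilon> \<in> \<Phi>" using eP positive_root by blast
        have not_opposite: "x \<noteq> - \<alpha> i" if "x \<in> P" for x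
          using positive_coef[OF that i] coef_simple[OF i i] coef_uminus[of "\<alpha> i" i] by auto
        have "N (\<alpha> k) \<epsilon> * N (\<alpha> i) (\<alpha> k + \<epsilon>) = N (\<alpha> i) \<epsilon> * N (\<alpha> k) (\<alpha> i + \<epsilon>)"
          using roots eR eP sum_notin not_opposite simple_positive[OF k(1)] unfolding \<delta> \<beta> \<gamma>_def
          by (intro N_jacobi) (auto simp: algebra_simps)
        \<comment> \<open>The remaining factor is
          \<open>N (\<alpha> k) (\<gamma> - \<alpha> k)\<close>, which is 1 by the choice of
          \<open>k\<close>.\<close>
        then have N_eq: "N (\<alpha> k) \<epsilon> * N (\<alpha> i) \<beta> = N (\<alpha> i) \<epsilon>"
          using Nk by (simp add: \<beta> \<delta> add.commute)
        have "height \<beta> = height \<epsilon> + 1" unfolding \<beta> using k by (intro height_add_simple)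
        then have ht: "nat \<lfloor>height \<epsilon>\<rfloor> < nat \<lfloor>height \<beta>\<rfloor>"
          using height_nonneg[OF eP] by (simp add: nat_less_eq_zless)
        \<comment> \<open>The induction hypothesis applies for \<open>i\<close> and for
          \<open>k\<close> because \<open>\<epsilon> + \<alpha> i = \<gamma> - \<alpha> k\<close>
          and \<open>\<epsilon> + \<alpha> k = \<beta>\<close> are positive roots.\<close>
        have IHi: "N (\<alpha> i) \<epsilon> = -1 \<longleftrightarrow> (\<forall>j. occurs_in l \<alpha> j \<epsilon> \<longrightarrow> j < i)"
          using less.hyps[OF ht i eP] k \<delta> by simp
        have IHk: "N (\<alpha> k) \<epsilon> = -1 \<longleftrightarrow> (\<forall>j. occurs_in l \<alpha> j \<epsilon> \<longrightarrow> j < k)"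
          using less.hyps[OF ht k(1) eP] b \<beta> by simp
        have units: "N (\<alpha> i) \<epsilon> = 1 \<or> N (\<alpha> i) \<epsilon> = -1" "N (\<alpha> k) \<epsilon> = 1 \<or> N (\<alpha> k) \<epsilon> = -1"
          using N_unit[of "\<alpha> i" \<epsilon>] N_unit[of "\<alpha> k" \<epsilon>] roots eR \<beta> \<delta> by (simp_all add: add.commute)
        \<comment> \<open>Otherwise \<open>i\<close> and \<open>k\<close> would both have neighbours
          in the support of \<open>\<epsilon>\<close>, all below \<open>k\<close>; the numbering
          would then join \<open>k\<close> to \<open>i\<close>, although \<open>\<alpha> k\<close>
          and \<open>\<alpha> i\<close> are orthogonal.\<close>
        have not_below_k: "\<not> (\<forall>j. occurs_in l \<alpha> j \<epsilon> \<longrightarrow> j < k)"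
        proof
          assume below: "\<forall>j. occurs_in l \<alpha> j \<epsilon> \<longrightarrow> j < k"
          have "\<epsilon> \<bullet> \<alpha> i < 0"
            using inner_roots_add[OF eR roots(2) roots(5)[unfolded \<delta>]] inner_self_pos[OF eR] by linarith
          then obtain j where j: "occurs_in l \<alpha> j \<epsilon>" "{j, i} \<in> dynkin_edges l \<alpha>"
            using occurs_in_neighbour[OF eP i] by blast
          have "\<epsilon> \<bullet> \<alpha> k < 0"
            using inner_roots_add[OF eR roots(3) roots(1)[unfolded \<beta>]] inner_self_pos[OF eR] by linarith
          then obtain m where m: "occurs_in l \<alpha> m \<epsilon>" "{m, k} \<in> dynkin_edges l \<alpha>"
            using occurs_in_neighbour[OF eP k(1)] by blast
          have "{k, i} \<in> dynkin_edges l \<alpha>"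
            using standard_numbering_adjacent[OF assms(4)] below j m lt by blast
          then show False using 2
            by (auto simp: dynkin_edges_def doubleton_eq_iff inner_commute)
        qed
        \<comment> \<open>Hence \<open>N (\<alpha> k) \<epsilon>\<close> is 1. Passing from
          \<open>\<epsilon>\<close> to \<open>\<beta>\<close> adds only \<open>k\<close> to the
          support, which is harmless as \<open>k < i\<close>.\<close>
        then have "N (\<alpha> i) \<beta> = N (\<alpha> i) \<epsilon>" using N_eq units IHk by auto
        moreover have "occurs_in l \<alpha> j \<beta> \<longleftrightarrow> occurs_in l \<alpha> j \<epsilon> \<or> j = k" for j
          using positive_coef[OF eP, of j] k
          by (cases "j \<in> {1..l}") (auto simp: \<beta> occurs_in_iff coef_add coef_simple)
        ultimately show ?thesis using IHi lt by auto
      qed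
    qed
  qed
qed

end
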